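(* Let $S$ be a finite nonempty set of positive integers. Then $S$ is a set of quadratic non-residues of infinitely many odd primes (i.e., there are infinitely many odd primes $p$ such that every element of $S$ is a quadratic non-residue of $p$) if and only if for every subset $T\subseteq S$ of odd cardinality, $\prod_{i\in T} i$ is not a perfect square.
   Context: For an odd prime $p$ and an integer $z$ not divisible by $p$, $z$ is a quadratic non-residue of $p$ if there is no integer $x$ with $x^2\equiv z\pmod p$. *)

theory Defs
  imports "HOL-Number_Theory.Number_Theory" "HOL-Computational_Algebra.Nth_Powers"
begin

definition quad_nonresidue :: "int \<Rightarrow> int \<Rightarrow> bool" where
  "quad_nonresidue p z \<longleftrightarrow> \<not> p dvd z \<and> \<not> QuadRes p z"

end

(* The Jacobi symbols (d/.) of the products d of subsets T of S are real characters, principal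
   (up to the modulus) exactly when d is a square. Up to finitely many p, the sum over T of
   (-1)^|T| (prod T / p) equals prod_{z in S} (1 - (z/p)), which vanishes unless all of S consists
   of non-residues of p. Weight this identity by p^(-s), sum over all primes p and let s tend to 1
   from above. The empty set contributes a divergent term; a nonsquare product contributes a bounded
   one, because sum_p psi(p) p^(-s) = ln L(s, psi) + O(1) and L(1, psi) is nonzero; a square product
   comes from a set of even size and contributes a nonnegative term. Hence the total diverges, and
   infinitely many primes have all of S as non-residues. Only quadratic reciprocity and real
   characters are needed, not Dirichlet's theorem.

   Conversely, a subset of odd size consisting of non-residues of p has a product of Legendre
   symbol -1. *)
theory Submission
  imports "HOL-Analysis.Analysis" Defs
begin

section \<open>Legendre symbols\<close>

lemma Legendre_values: "Legendre a p \<in> {-1, 0, 1}"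
  by (simp add: Legendre_def)

lemma Legendre_eq_0_iff: "Legendre a p = 0 \<longleftrightarrow> p dvd a"
  by (simp add: Legendre_def cong_0_iff)

lemma Legendre_cong:
  assumes "[a = b] (mod p)"
  shows "Legendre a p = Legendre b p"
proof -
  have "[a = 0] (mod p) \<longleftrightarrow> [b = 0] (mod p)"
    using assms by (metis cong_sym cong_trans)
  moreover have "QuadRes p a \<longleftrightarrow> QuadRes p b"
    unfolding QuadRes_def using assms by (metis cong_sym cong_trans)
  ultimately show ?thesis by (simp add: Legendre_def)
qed

lemma Legendre_1 [simp]: "prime p \<Longrightarrow> Legendre 1 (int p) = 1"
proof -
  assume "prime p"
  then have "\<not> int p dvd 1" by (auto simp: prime_gt_1_nat)
  moreover have "QuadRes (int p) 1" unfolding QuadRes_def by (rule exI[of _ 1]) simp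
  ultimately show ?thesis by (simp add: Legendre_def cong_0_iff)
qed

text \<open>Euler's criterion makes both sides congruent modulo \<open>p\<close>; they differ by at
  most 2 in absolute value, and \<open>p > 2\<close>, so the congruence is an equality.\<close>

lemma Legendre_mult:
  assumes "prime p" "2 < p"
  shows "Legendre (a * b) (int p) = Legendre a (int p) * Legendre b (int p)"
proof -
  have "[Legendre (a * b) p = (a * b) ^ ((p - 1) div 2)] (mod p)"
    using euler_criterion assms by blast
  moreover have "[Legendre a p * Legendre b p = a ^ ((p - 1) div 2) * b ^ ((p - 1) div 2)] (mod p)"
    using euler_criterion assms by (intro cong_mult) blast+
  ultimately have "[Legendre (a * b) p = Legendre a p * Legendre b p] (mod p)"
    by (metis cong_sym cong_trans power_mult_distrib)
  then have dvd: "int p dvd Legendre (a * b) p - Legendre a p * Legendre b p" (is "_ dvd ?x")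
    by (simp add: cong_iff_dvd_diff)
  have "\<bar>?x\<bar> \<le> 2"
    using Legendre_values[of "a*b" p] Legendre_values[of a p] Legendre_values[of b p] by auto
  with assms dvd have "?x = 0"
    using zdvd_not_zless[of "\<bar>?x\<bar>" "int p"] by (cases "?x = 0") auto
  then show ?thesis by simp
qed

lemma Legendre_prod_mset:
  assumes "prime p" "2 < p"
  shows "Legendre (\<Prod>x\<in>#A. f x) (int p) = (\<Prod>x\<in>#A. Legendre (f x) (int p))"
  by (induction A) (simp_all add: Legendre_mult assms)

lemma Legendre_prod:
  assumes "prime p" "2 < p"
  shows "Legendre (\<Prod>x\<in>A. f x) (int p) = (\<Prod>x\<in>A. Legendre (f x) (int p))"
  using assms by (induction A rule: infinite_finite_induct) (simp_all add: Legendre_mult)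

text \<open>Gauss's lemma: the exponent of -1 is the number of doubles \<open>2 * x\<close> with
  \<open>x \<le> m\<close> that exceed \<open>m\<close>, and its parity depends on \<open>p\<close>
  modulo 8.\<close>

lemma Legendre_2:
  assumes "prime p" "2 < p"
  shows "Legendre 2 (int p) = (if p mod 8 = 1 \<or> p mod 8 = 7 then 1 else -1)"
proof -
  interpret GAUSS p 2
    using assms by unfold_locales
      (auto simp: cong_0_iff dest!: zdvd_imp_le)
  define m where "m = (p - 1) div 2"
  have p: "p = 2 * m + 1" using odd_p assms unfolding m_def by presburger
  \<comment> \<open>The doubles of \<open>1\<close>, ..., \<open>m\<close> are all below
    \<open>p\<close>, so reducing them modulo \<open>p\<close> changes nothing.\<close>
  have C: "C = (\<lambda>x. 2 * x) ` {0<..int m}"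
    unfolding C_def B_def A_def image_image
    by (rule image_cong) (auto simp: p)
  have "E = (\<lambda>x. 2 * x) ` {int (m div 2)<..int m}"
    unfolding E_def C using p by (auto simp: zdiv_int)
  then have "card E = m - m div 2"
    by (simp add: card_image inj_on_def)
  then have L: "Legendre 2 (int p) = (-1) ^ (m - m div 2)"
    using gauss_lemma by simp
  have "even (m - m div 2) \<longleftrightarrow> p mod 8 = 1 \<or> p mod 8 = 7"
    unfolding p by presburger
  then show ?thesis unfolding L by auto
qed

text \<open>Squaring modulo \<open>q\<close> identifies \<open>1\<close> and \<open>q - 1\<close>,
  so it is not injective on the residues and hence misses one. The missed residue is nonzero because
  0 is a square.\<close>

lemma exists_nonresidue:
  assumes "prime q" "2 < q"
  obtains a :: nat where "Legendre (int a) (int q) = -1"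
proof -
  define f where "f = (\<lambda>x::nat. x ^ 2 mod q)"
  have "f 1 = f (q - 1)"
  proof -
    have "(q - 1) ^ 2 = 1 + q * (q - 2)"
      using assms by (auto simp: power2_eq_square algebra_simps nat_diff_split dest!: less_imp_Suc_add)
    then have "(q - 1) ^ 2 mod q = 1 mod q" by (metis mod_mult_self2)
    then show ?thesis by (simp add: f_def)
  qed
  then have "\<not> inj_on f {..<q}"
    using assms inj_onD[of f "{..<q}" 1 "q - 1"] by auto
  moreover have "f ` {..<q} \<subseteq> {..<q}" using assms by (auto simp: f_def)
  ultimately have "f ` {..<q} \<noteq> {..<q}"
    using eq_card_imp_inj_on[of "{..<q}" f] by auto
  with \<open>f ` {..<q} \<subseteq> {..<q}\<close> obtain a where a: "a < q" "a \<notin> f ` {..<q}" by blast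
  have "f 0 = 0" by (simp add: f_def)
  then have "a \<noteq> 0" using a assms by (metis image_eqI lessThan_iff)
  have "\<not> QuadRes (int q) (int a)"
  proof
    assume "QuadRes (int q) (int a)"
    then obtain y where y: "[y ^ 2 = int a] (mod int q)" unfolding QuadRes_def by blast
    define x where "x = nat (y mod int q)"
    have x: "int x = y mod int q" using assms by (simp add: x_def)
    have "int (f x) = int a"
      unfolding f_def using y a by (simp add: x zmod_int power_mod cong_def)
    moreover have "x < q" using x assms by (metis of_nat_0_less_iff of_nat_less_iff pos_mod_bound prime_gt_0_nat)
    ultimately show False using a by auto
  qed
  moreover have "\<not> int q dvd int a"
    using a \<open>a \<noteq> 0\<close> by (auto dest: dvd_imp_le)
  ultimately have "Legendre (int a) (int q) = -1"
    by (simp add: Legendre_def cong_0_iff)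
  then show ?thesis by (rule that)
qed

section \<open>Jacobi symbols as periodic characters\<close>

text \<open>For a prime \<open>q\<close>, the value that quadratic reciprocity and the law for $2$ assign to the
  Jacobi symbol $(q/n)$ of an odd number \<open>n\<close>. Unlike $(q/n)$ itself, it is visibly periodic
  in \<open>n\<close>.\<close>

definition recip_symbol :: "nat \<Rightarrow> nat \<Rightarrow> int" where
  "recip_symbol q n = (if q = 2 then (if n mod 8 = 1 \<or> n mod 8 = 7 then 1 else -1)
              else Legendre (int n) (int q) * (if q mod 4 = 3 \<and> n mod 4 = 3 then -1 else 1))"

lemma prime_gt_2: "prime q \<Longrightarrow> q \<noteq> 2 \<Longrightarrow> 2 < (q::nat)"
  using prime_ge_2_nat[of q] by linarith

text \<open>The sign conditions modulo 8 and modulo 4 are characters on odd residues only, which is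
  checked by cases; the rest is multiplicativity of the Legendre symbol.\<close>

lemma recip_symbol_mult:
  assumes "prime q" "odd m" "odd n"
  shows "recip_symbol q (m * n) = recip_symbol q m * recip_symbol q n"
proof (cases "q = 2")
  case True
  have "m mod 8 \<in> {1,3,5,7}" "n mod 8 \<in> {1,3,5,7}"
    using assms by (simp; presburger)+
  moreover have "(m * n) mod 8 = (m mod 8) * (n mod 8) mod 8" by (simp add: mod_mult_eq)
  ultimately show ?thesis by (auto simp: recip_symbol_def True)
next
  case False
  have "m mod 4 \<in> {1,3}" "n mod 4 \<in> {1,3}"
    using assms by (simp; presburger)+
  moreover have "(m * n) mod 4 = (m mod 4) * (n mod 4) mod 4" by (simp add: mod_mult_eq)
  moreover have "Legendre (int m * int n) (int q) = Legendre (int m) (int q) * Legendre (int n) (int q)"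
    using assms False by (intro Legendre_mult prime_gt_2)
  ultimately show ?thesis by (auto simp: recip_symbol_def False)
qed

lemma recip_symbol_cong:
  assumes "[m = n] (mod 8)" "q = 2 \<or> [m = n] (mod q)"
  shows "recip_symbol q m = recip_symbol q n"
proof -
  have "m mod 8 = n mod 8" using assms(1) by (simp add: cong_def)
  moreover from this have "m mod 4 = n mod 4"
    by (metis mod_mod_cancel dvd_triv_left mult_2_right numeral_Bit0)
  moreover have "q = 2 \<or> Legendre (int m) (int q) = Legendre (int n) (int q)"
    using assms(2) by (auto intro!: Legendre_cong simp: cong_int_iff)
  ultimately show ?thesis by (auto simp: recip_symbol_def)
qed

lemma recip_symbol_1 [simp]: "prime q \<Longrightarrow> recip_symbol q 1 = 1" "prime q \<Longrightarrow> recip_symbol q (Suc 0) = 1"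
  by (simp_all add: recip_symbol_def)

lemma recip_symbol_values:
  assumes "prime q" "coprime n q"
  shows "recip_symbol q n \<in> {-1, 1}"
proof -
  have "\<not> int q dvd int n"
    using assms by (metis coprime_absorb_right int_dvd_int_iff not_prime_unit)
  then have "Legendre (int n) (int q) \<noteq> 0" by (simp add: Legendre_eq_0_iff)
  then show ?thesis using Legendre_values[of "int n" "int q"] by (auto simp: recip_symbol_def)
qed

text \<open>This is where reciprocity enters. Multiplying the law by \<open>Legendre p q\<close>,
  whose square is 1, solves it for \<open>Legendre q p\<close>.\<close>

lemma recip_symbol_prime:
  assumes "prime q" "prime p" "2 < p" "p \<noteq> q"
  shows "recip_symbol q p = Legendre (int q) (int p)"
proof (cases "q = 2")
  case True
  then show ?thesis using Legendre_2[of p] assms by (simp add: recip_symbol_def)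
next
  case False
  then have q: "2 < q" using assms prime_gt_2 by blast
  have "Legendre (int p) (int q) \<noteq> 0"
    using assms primes_dvd_imp_eq[of q p] by (auto simp: Legendre_eq_0_iff)
  then have L: "Legendre (int p) (int q) * Legendre (int p) (int q) = 1"
    using Legendre_values[of "int p" "int q"] by auto
  have QR: "Legendre p q * Legendre q p = (-1::int) ^ ((p - 1) div 2 * ((q - 1) div 2))"
    using Quadratic_Reciprocity assms q by blast
  have "odd p" "odd q" using assms q prime_odd_nat by blast+
  then have "even ((p - 1) div 2 * ((q - 1) div 2)) \<longleftrightarrow> \<not> (q mod 4 = 3 \<and> p mod 4 = 3)"
    unfolding even_mult_iff by presburger
  then have sgn: "(-1::int) ^ ((p - 1) div 2 * ((q - 1) div 2)) = (if q mod 4 = 3 \<and> p mod 4 = 3 then -1 else 1)"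
    by (simp add: minus_one_power_iff)
  have "Legendre q p = Legendre p q * (Legendre p q * Legendre q p)"
    using L by (simp add: mult.assoc[symmetric])
  then show ?thesis using False unfolding QR sgn by (simp add: recip_symbol_def)
qed

text \<open>The Jacobi symbol $(d/n)$ for \<open>d\<close> dividing \<open>M\<close>, set to $0$ at all \<open>n\<close> not coprime to $2M$. The
  common modulus makes the characters of different divisors of \<open>M\<close> multiply exactly.\<close>

definition jacobi_char :: "nat \<Rightarrow> nat \<Rightarrow> nat \<Rightarrow> real" where
  "jacobi_char M d n = (if coprime n (2 * M) then of_int (\<Prod>q\<in>#prime_factorization d. recip_symbol q n) else 0)"

lemma jacobi_char_mult: "jacobi_char M d (m * n) = jacobi_char M d m * jacobi_char M d n"
proof (cases "coprime m (2 * M) \<and> coprime n (2 * M)")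
  case True
  then have odd: "odd m" "odd n" by (auto simp: coprime_right_2_iff_odd)
  have "(\<Prod>q\<in>#prime_factorization d. recip_symbol q (m * n)) =
        (\<Prod>q\<in>#prime_factorization d. recip_symbol q m * recip_symbol q n)"
    by (intro arg_cong[of _ _ prod_mset] image_mset_cong recip_symbol_mult odd) auto
  with True show ?thesis by (simp add: jacobi_char_def prod_mset.distrib)
qed (auto simp: jacobi_char_def)

lemma jacobi_char_1 [simp]: "jacobi_char M d (Suc 0) = 1"
proof -
  have "(\<Prod>q\<in>#prime_factorization d. recip_symbol q 1) = (\<Prod>q\<in>#prime_factorization d. 1)"
    by (intro arg_cong[of _ _ prod_mset] image_mset_cong recip_symbol_1) auto
  then show ?thesis by (simp add: jacobi_char_def)
qed

lemma jacobi_char_values: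
  assumes "M > 0" "d dvd M"
  shows "jacobi_char M d n \<in> {-1, 0, 1}"
proof (cases "coprime n (2 * M)")
  case True
  have "(\<Prod>q\<in>#A. recip_symbol q n) \<in> {-1, 1}" if "\<And>q. q \<in># A \<Longrightarrow> recip_symbol q n \<in> {-1,1}" for A
    using that by (induction A) (auto, fastforce+)
  moreover have "recip_symbol q n \<in> {-1, 1}" if "q \<in># prime_factorization d" for q
  proof (rule recip_symbol_values)
    have "q dvd M" using that assms by (auto dest: dvd_trans)
    with True show "coprime n q" by (meson coprime_divisors dvd_refl dvd_mult)
  qed (use that in auto)
  ultimately have "(\<Prod>q\<in>#prime_factorization d. recip_symbol q n) \<in> {-1, 1}" by blast
  then show ?thesis using True by (auto simp: jacobi_char_def)
qed (auto simp: jacobi_char_def)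

lemma jacobi_char_cong:
  assumes "M > 0" "d dvd M" "[m = n] (mod (8 * M))"
  shows "jacobi_char M d m = jacobi_char M d n"
proof -
  have "[m = n] (mod (2 * M))"
    using assms(3) by (rule cong_dvd_modulus_nat) auto
  then have "coprime m (2 * M) \<longleftrightarrow> coprime n (2 * M)"
    by (metis cong_imp_coprime cong_sym)
  moreover have "recip_symbol q m = recip_symbol q n" if "q \<in># prime_factorization d" for q
  proof (rule recip_symbol_cong)
    have "q dvd M" using that assms by (auto dest: dvd_trans)
    then show "q = 2 \<or> [m = n] (mod q)"
      using assms(3) by (auto intro: cong_dvd_modulus_nat)
    show "[m = n] (mod 8)"
      using assms(3) by (rule cong_dvd_modulus_nat) auto
  qed
  then have "(\<Prod>q\<in>#prime_factorization d. recip_symbol q m) = (\<Prod>q\<in>#prime_factorization d. recip_symbol q n)"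
    by (intro arg_cong[of _ _ prod_mset] image_mset_cong) auto
  ultimately show ?thesis by (simp add: jacobi_char_def)
qed

text \<open>Reciprocity is applied to each prime factor of \<open>d\<close>; multiplicativity of the
  Legendre symbol in its upper argument reassembles \<open>d\<close>.\<close>

lemma jacobi_char_prime:
  assumes "M > 0" "d dvd M" "prime p" "coprime p (2 * M)"
  shows "jacobi_char M d p = of_int (Legendre (int d) (int p))"
proof -
  have p: "2 < p"
    using assms by (intro prime_gt_2) (auto simp: coprime_right_2_iff_odd)
  have d: "d > 0" using assms by (auto intro: Nat.gr0I)
  have "recip_symbol q p = Legendre (int q) (int p)" if "q \<in># prime_factorization d" for q
  proof (rule recip_symbol_prime)
    have "q dvd M" using that assms by (auto dest: dvd_trans)
    then have "coprime p q" using assms by (meson coprime_divisors dvd_refl dvd_mult)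
    then show "p \<noteq> q" using assms(3) by auto
  qed (use that p assms in auto)
  then have "(\<Prod>q\<in>#prime_factorization d. recip_symbol q p) = (\<Prod>q\<in>#prime_factorization d. Legendre (int q) (int p))"
    by (intro arg_cong[of _ _ prod_mset] image_mset_cong) auto
  also have "\<dots> = Legendre (\<Prod>q\<in>#prime_factorization d. int q) (int p)"
    using assms p by (simp add: Legendre_prod_mset)
  also have "(\<Prod>q\<in>#A. int q) = int (prod_mset A)" for A
    by (induction A) simp_all
  also have "prod_mset (prime_factorization d) = d"
    using d by (simp add: prod_mset_prime_factorization_nat)
  finally show ?thesis using assms by (simp add: jacobi_char_def)
qed

text \<open>The coprimality factor matters for empty \<open>T\<close>: the product over
  \<open>T\<close> is then 1 everywhere, whereas the left side is 0 at \<open>n\<close> not coprime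
  to \<open>2 * M\<close>.\<close>

lemma jacobi_char_prod:
  assumes "finite T" "\<And>z. z \<in> T \<Longrightarrow> z > 0"
  shows "jacobi_char M (\<Prod>T) n = (if coprime n (2 * M) then 1 else 0) * (\<Prod>z\<in>T. jacobi_char M z n)"
proof (cases "coprime n (2 * M)")
  case True
  have "(\<Prod>q\<in>#prime_factorization (\<Prod>T). recip_symbol q n) = (\<Prod>z\<in>T. \<Prod>q\<in>#prime_factorization z. recip_symbol q n)"
    using assms
  proof (induction T rule: finite_induct)
    case (insert x F)
    have "x > 0" "\<Prod>F > 0" using insert by (auto intro!: prod_pos)
    then have "prime_factorization (x * \<Prod>F) = prime_factorization x + prime_factorization (\<Prod>F)"
      by (intro prime_factorization_mult) auto
    then show ?case using insert by simp
  qed auto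
  with True show ?thesis by (simp add: jacobi_char_def of_int_prod)
next
  case False
  then show ?thesis unfolding jacobi_char_def by (simp only: if_False mult_zero_left)
qed

lemma jacobi_char_square_nonneg:
  assumes "M > 0" "d dvd M" "is_nth_power 2 d"
  shows "jacobi_char M d n \<ge> 0"
proof -
  obtain y where d: "d = y * y" using assms by (auto simp: is_nth_power_def power2_eq_square)
  have "y > 0" using assms d by (auto intro: Nat.gr0I)
  then have "jacobi_char M d n = (if coprime n (2 * M) then (of_int (\<Prod>q\<in>#prime_factorization y. recip_symbol q n))\<^sup>2 else 0)"
    by (simp add: jacobi_char_def d prime_factorization_mult power2_eq_square)
  then show ?thesis by simp
qed

text \<open>A nonsquare \<open>d\<close> contains some prime \<open>q\<close> to an odd power. The
  Chinese remainder theorem gives an \<open>n\<close> whose symbol is -1 at \<open>q\<close> and 1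
  at every other prime factor of \<open>d\<close>.\<close>

lemma jacobi_char_minus_one:
  assumes "M > 0" "d dvd M" "\<not> is_nth_power 2 d"
  obtains n where "jacobi_char M d n = -1"
proof -
  have d: "d > 0" using assms by (auto intro: Nat.gr0I)
  obtain q where q: "prime q" "odd (multiplicity q d)"
    using assms(3) is_nth_power_conv_multiplicity_nat[of 2 d] by auto
  define k where "k = multiplicity q M"
  obtain M' where M': "M = q ^ k * M'" "\<not> q dvd M'"
    using assms(1) q multiplicity_decompose'[of M q] unfolding k_def by (metis not_prime_unit less_irrefl)
  have cop: "coprime q M'" using q M' by (simp add: prime_imp_coprime)
  have "\<exists>n. coprime n (2 * M) \<and> recip_symbol q n = -1 \<and> [n = 1] (mod M') \<and> [n = 1] (mod 4) \<and>
          (q \<noteq> 2 \<longrightarrow> [n = 1] (mod 8))"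
  proof (cases "q = 2")
    case True
    have "coprime 8 M'" using cop True coprime_power_left_iff[of 2 3 M'] by simp
    \<comment> \<open>The residue 5 modulo 8 has symbol -1 at 2, yet is 1 modulo 4, so no
      reciprocity sign appears at the odd primes.\<close>
    then obtain n where n: "[n = 5] (mod 8)" "[n = 1] (mod M')"
      using binary_chinese_remainder_nat[of 8 M' 5 1] by blast
    have n8: "n mod 8 = 5" using n(1) by (simp add: cong_def)
    then have "odd n" by presburger
    moreover have "coprime n M'" using n(2) by (metis cong_imp_coprime cong_sym coprime_1_left)
    ultimately have "coprime n (2 * M)" unfolding M' True by (simp add: coprime_right_2_iff_odd)
    moreover have "recip_symbol q n = -1" using n8 by (simp add: recip_symbol_def True)
    moreover have "n mod 4 = 1" using n8 by presburger
    ultimately show ?thesis using n True by (auto simp: cong_def)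
  next
    case False
    then have q2: "2 < q" using q prime_gt_2 by blast
    then have "odd q" using q prime_odd_nat by blast
    obtain a :: nat where a: "Legendre (int a) (int q) = -1"
      using exists_nonresidue q q2 by blast
    have "coprime q 8" using \<open>odd q\<close> coprime_power_right_iff[of q 2 3] by (simp add: coprime_right_2_iff_odd)
    then have "coprime q (8 * M')" using cop by simp
    \<comment> \<open>Being 1 modulo 8 makes the symbol at 2 and all reciprocity signs trivial, so
      only the non-residue \<open>a\<close> modulo \<open>q\<close> counts.\<close>
    then obtain n where n: "[n = a] (mod q)" "[n = 1] (mod (8 * M'))"
      using binary_chinese_remainder_nat[of q "8 * M'" a 1] by blast
    have n8: "[n = 1] (mod 8)" "[n = 1] (mod M')"
      by (rule cong_dvd_modulus_nat[OF n(2)], simp)+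
    have n4: "[n = 1] (mod 4)" by (rule cong_dvd_modulus_nat[OF n8(1)]) simp
    have L: "Legendre (int n) (int q) = -1"
      using a Legendre_cong[of "int n" "int a" "int q"] n(1) by (simp add: cong_int_iff)
    then have "\<not> q dvd n" using Legendre_eq_0_iff[of "int n" "int q"] by simp
    then have "coprime n q" using q prime_imp_coprime coprime_commute by blast
    moreover have "coprime n (8 * M')" using n(2) by (metis cong_imp_coprime cong_sym coprime_1_left)
    then have "odd n" "coprime n M'" by (auto simp: coprime_right_2_iff_odd)
    ultimately have "coprime n (2 * M)" unfolding M' by (simp add: coprime_right_2_iff_odd)
    moreover have "recip_symbol q n = -1" using L False n4 by (simp add: recip_symbol_def cong_def)
    ultimately show ?thesis using n8 n4 by blast
  qed
  then obtain n where n: "coprime n (2 * M)" "recip_symbol q n = -1" "[n = 1] (mod M')" "[n = 1] (mod 4)"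
    "q \<noteq> 2 \<Longrightarrow> [n = 1] (mod 8)" by blast
  have recip_symbol_r: "recip_symbol r n = 1" if "r \<in># prime_factorization d" "r \<noteq> q" for r
  proof -
    have r: "prime r" "r dvd M" using that assms by (auto dest: dvd_trans)
    then have "r dvd M'" using that q unfolding M'
      by (metis prime_dvd_mult_iff prime_dvd_power primes_dvd_imp_eq)
    then have nr: "[n = 1] (mod r)" using n(3) by (rule cong_dvd_modulus_nat[rotated])
    show ?thesis
    proof (cases "r = 2")
      case True
      then show ?thesis using n(5) that by (simp add: recip_symbol_def cong_def)
    next
      case False
      have "Legendre (int n) (int r) = Legendre (int 1) (int r)"
        using nr by (intro Legendre_cong) (simp only: cong_int_iff)
      then show ?thesis using n(4) False r by (simp add: recip_symbol_def cong_def)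
    qed
  qed
  have "(\<Prod>r\<in>#A. recip_symbol r n) = (-1) ^ count A q" if "\<And>r. r \<in># A \<Longrightarrow> r \<noteq> q \<Longrightarrow> recip_symbol r n = 1" for A
    using that by (induction A) (auto simp: n(2))
  from this[of "prime_factorization d"] recip_symbol_r have "jacobi_char M d n = -1"
    using q n(1) d by (simp add: jacobi_char_def count_prime_factorization)
  then show ?thesis by (rule that)
qed

lemma jacobi_char_add_period:
  assumes "M > 0" "d dvd M"
  shows "jacobi_char M d (n + 8 * M) = jacobi_char M d n"
  by (rule jacobi_char_cong) (use assms in \<open>auto simp: cong_def\<close>)

text \<open>Multiplication by an \<open>m\<close> of value -1 permutes the residues modulo
  \<open>8 * M\<close> and negates every term, so the sum equals its own negative.\<close>

lemma jacobi_char_sum_period: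
  assumes "M > 0" "d dvd M" "\<not> is_nth_power 2 d"
  shows "(\<Sum>n<8*M. jacobi_char M d n) = 0"
proof -
  obtain m where m: "jacobi_char M d m = -1" using jacobi_char_minus_one[OF assms] .
  define N where "N = 8 * M"
  have "coprime m (2 * M)" using m by (auto simp: jacobi_char_def split: if_splits)
  then have cop: "coprime m N"
    using coprime_power_right_iff[of m 2 3] by (simp add: N_def coprime_right_2_iff_odd)
  have N: "N > 0" using assms by (simp add: N_def)
  have "inj_on (\<lambda>n. m * n mod N) {..<N}"
  proof (rule inj_onI)
    fix x y assume "x \<in> {..<N}" "y \<in> {..<N}" "m * x mod N = m * y mod N"
    then show "x = y"
      using cong_mult_lcancel_nat[OF cop] by (auto simp: cong_def)
  qed
  moreover have "(\<lambda>n. m * n mod N) ` {..<N} \<subseteq> {..<N}" using N by auto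
  ultimately have "bij_betw (\<lambda>n. m * n mod N) {..<N} {..<N}"
    by (simp add: bij_betw_def endo_inj_surj)
  then have "(\<Sum>n<N. jacobi_char M d (m * n mod N)) = (\<Sum>n<N. jacobi_char M d n)"
    by (rule sum.reindex_bij_betw)
  moreover have "jacobi_char M d (m * n mod N) = - jacobi_char M d n" for n
    using jacobi_char_cong[OF assms(1,2), of "m * n mod N" "m * n"] m by (simp add: jacobi_char_mult N_def cong_def)
  ultimately show ?thesis by (simp add: sum_negf N_def)
qed

section \<open>Real characters and nonvanishing at 1\<close>

text \<open>Summation by parts: the differences \<open>b n - b (Suc n)\<close> are nonnegative and
  telescope.\<close>

lemma Abel_bound:
  fixes f b :: "nat \<Rightarrow> real"
  assumes f: "\<And>k. \<bar>\<Sum>n<k. f n\<bar> \<le> C"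
    and dec: "\<And>n. b (Suc n) \<le> b n" and nonneg: "\<And>n. b n \<ge> 0"
  shows "\<bar>\<Sum>n<k. f n * b n\<bar> \<le> C * b 0"
proof -
  define S where "S = (\<lambda>k. \<Sum>n<k. f n)"
  have "(\<Sum>n<k. f n * b n) = S k * b k + (\<Sum>n<k. S (Suc n) * (b n - b (Suc n)))"
    by (induction k) (auto simp: S_def algebra_simps)
  also have "\<bar>\<dots>\<bar> \<le> \<bar>S k * b k\<bar> + (\<Sum>n<k. \<bar>S (Suc n) * (b n - b (Suc n))\<bar>)"
    by (intro abs_triangle_ineq[THEN order_trans] add_mono order_refl sum_abs)
  also have "\<dots> \<le> C * b k + (\<Sum>n<k. C * (b n - b (Suc n)))"
    using f dec nonneg unfolding S_def
    by (intro add_mono sum_mono) (auto simp: abs_mult simp del: sum.lessThan_Suc intro!: mult_right_mono)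
  also have "(\<Sum>n<k. C * (b n - b (Suc n))) = C * (b 0 - b k)"
    by (simp add: sum_distrib_left[symmetric] sum_lessThan_telescope')
  finally show ?thesis by (simp add: algebra_simps)
qed

text \<open>Terms \<open>i\<close> and \<open>n - 1 - i\<close> of the geometric sum are paired; by
  the inequality of means each pair is at least \<open>2 * y ^ (n - 1)\<close>.\<close>

lemma mult_le_geometric_sum:
  fixes y :: real
  shows "real n * y ^ (n - 1) \<le> (\<Sum>i<n. (y\<^sup>2) ^ i)"
proof -
  have "2 * (real n * y ^ (n - 1)) = (\<Sum>i<n. 2 * y ^ (n - 1))"
    by simp
  also have "\<dots> \<le> (\<Sum>i<n. (y\<^sup>2) ^ i + (y\<^sup>2) ^ (n - Suc i))"
  proof (rule sum_mono)
    fix i assume "i \<in> {..<n}"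
    then have "y ^ (n - 1) = y ^ i * y ^ (n - Suc i)" by (simp flip: power_add)
    then show "2 * y ^ (n - 1) \<le> (y\<^sup>2) ^ i + (y\<^sup>2) ^ (n - Suc i)"
      using sum_squares_bound[of "y ^ i" "y ^ (n - Suc i)"]
      by (simp flip: power_mult add: mult.commute mult.left_commute)
  qed
  also have "\<dots> = 2 * (\<Sum>i<n. (y\<^sup>2) ^ i)"
    using sum.nat_diff_reindex[of "\<lambda>i. (y\<^sup>2) ^ i" n] by (simp add: sum.distrib)
  finally show ?thesis by simp
qed

text \<open>The weights of Monsky's proof that $L(1, \psi) \neq 0$: if $L(1, \psi) = 0$, then summing
  \<open>\<psi> n * monsky x n\<close> gives minus the Lambert series $\sum \psi(n) x^n / (1 - x^n)$. As the weights
  decrease to $0$ from $1$, the series stays bounded for $x \to 1$; but its power series has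
  nonnegative coefficients, which are at least $1$ at the squares.\<close>

definition monsky :: "real \<Rightarrow> nat \<Rightarrow> real" where
  "monsky x n = 1 / (real n * (1 - x)) - x ^ n / (1 - x ^ n)"

text \<open>With \<open>A n = 1 + x + ... + x ^ (n - 1)\<close> a factor \<open>1 / (1 - x)\<close>
  splits off, and the claim reduces to \<open>n * (n + 1) * x ^ n \<le> A n * A (n + 1)\<close>.
  This follows from \<open>mult_le_geometric_sum\<close> at \<open>sqrt x\<close>.\<close>

lemma monsky_antimono:
  assumes x: "0 < x" "x < 1" and n: "n \<ge> 1"
  shows "monsky x (Suc n) \<le> monsky x n"
proof -
  define A where "A = (\<lambda>n. \<Sum>i<n. x ^ i)"
  have geom: "1 - x ^ k = (1 - x) * A k" for k
    using one_diff_power_eq[of x k] by (simp add: A_def)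
  have A_Suc: "A (Suc k) = 1 + x * A k" for k
    unfolding A_def by (subst sum.lessThan_Suc_shift) (simp add: sum_distrib_left)
  have "A k > 0" if "k \<ge> 1" for k
    unfolding A_def using x that by (intro sum_pos) (auto simp: lessThan_empty_iff)
  then have pos: "A n > 0" "A (Suc n) > 0" using n by auto
  define y where "y = sqrt x"
  have y: "0 < y" "y < 1" "y\<^sup>2 = x" using x by (auto simp: y_def)
  have "real n * real (Suc n) * x ^ n = (real n * y ^ n) * (real (Suc n) * y ^ n)"
    by (simp add: y(3)[symmetric] power2_eq_square power_mult_distrib)
  \<comment> \<open>Only the first factor grows, its exponent dropping from \<open>n\<close> to
    \<open>n - 1\<close>; both now have the shape that \<open>mult_le_geometric_sum\<close>
    bounds.\<close>
  also have "\<dots> \<le> (real n * y ^ (n - 1)) * (real (Suc n) * y ^ (Suc n - 1))"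
    using y by (intro mult_mono mult_left_mono power_decreasing) auto
  also have "\<dots> \<le> A n * A (Suc n)"
    unfolding A_def using mult_le_geometric_sum[of n y] mult_le_geometric_sum[of "Suc n" y] y pos
    by (intro mult_mono) (auto simp: A_def)
  finally have *: "real n * real (Suc n) * x ^ n \<le> A n * A (Suc n)" .
  have frac: "t / D \<le> 1 / c" if "c > 0" "D > 0" "c * t \<le> D" for c D t :: real
    using that by (simp add: field_simps)
  have "x ^ n / A n - x ^ Suc n / A (Suc n) = x ^ n * (A (Suc n) - x * A n) / (A n * A (Suc n))"
    using pos by (simp add: field_simps)
  also have "\<dots> = x ^ n / (A n * A (Suc n))" by (simp add: A_Suc)
  also have "\<dots> \<le> 1 / (real n * real (Suc n))"
    using frac[OF _ _ *] pos n by simp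
  also have "\<dots> = 1 / real n - 1 / real (Suc n)" using n by (simp add: field_simps)
  finally have "1 / real (Suc n) - x ^ Suc n / A (Suc n) \<le> 1 / real n - x ^ n / A n" by simp
  then have "(1 / real (Suc n) - x ^ Suc n / A (Suc n)) / (1 - x) \<le> (1 / real n - x ^ n / A n) / (1 - x)"
    using x by (intro divide_right_mono) auto
  moreover have "monsky x k = (1 / real k - x ^ k / A k) / (1 - x)" for k
    using x unfolding monsky_def geom by (simp add: diff_divide_distrib mult.commute)
  ultimately show ?thesis by simp
qed

lemma monsky_tendsto_0:
  assumes "0 < x" "x < 1"
  shows "monsky x \<longlonglongrightarrow> 0"
proof -
  have "(\<lambda>n. x ^ n) \<longlonglongrightarrow> 0" using assms by (intro LIMSEQ_realpow_zero) auto
  then have "(\<lambda>n. inverse (real n) / (1 - x) - x ^ n / (1 - x ^ n)) \<longlonglongrightarrow> 0 / (1 - x) - 0 / (1 - 0)"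
    using assms lim_inverse_n by (intro tendsto_intros) auto
  then show ?thesis by (simp add: monsky_def[abs_def] field_simps)
qed

lemma summable_powr_uminus: "s > 1 \<Longrightarrow> summable (\<lambda>n. real n powr -s)"
  using summable_real_powr_iff[of "-s"] by simp

text \<open>The vanishing sum over one period expresses that the character is nonprincipal, and is
  the source of convergence at \<open>s = 1\<close>.\<close>

locale real_character =
  fixes \<psi> :: "nat \<Rightarrow> real" and N :: nat
  assumes mult: "\<psi> (m * n) = \<psi> m * \<psi> n"
    and one: "\<psi> (Suc 0) = 1" and zero: "\<psi> 0 = 0"
    and vals: "\<psi> n \<in> {-1, 0, 1}"
    and period: "\<psi> (n + N) = \<psi> n" and N_pos: "N > 0"
    and sum_period: "(\<Sum>n<N. \<psi> n) = 0"
begin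

lemma abs_le_1: "\<bar>\<psi> n\<bar> \<le> 1"
  using vals[of n] by auto

lemma power: "\<psi> (m ^ k) = \<psi> m ^ k"
  by (induction k) (simp_all add: mult one)

text \<open>Full periods contribute nothing, which leaves fewer than \<open>N\<close> terms of
  absolute value at most 1.\<close>

lemma partial_sum_bound: "\<bar>\<Sum>n<k. \<psi> n\<bar> \<le> N"
proof -
  have shift: "(\<Sum>n<k + N. \<psi> n) = (\<Sum>n<k. \<psi> n)" for k
    by (induction k) (simp_all add: sum_period period)
  show ?thesis
  proof (induction k rule: less_induct)
    case (less k)
    show ?case
    proof (cases "k < N")
      case True
      have "\<bar>\<Sum>n<k. \<psi> n\<bar> \<le> (\<Sum>n<k. \<bar>\<psi> n\<bar>)" by (rule sum_abs)
      also have "\<dots> \<le> (\<Sum>n<k. 1)" by (intro sum_mono abs_le_1)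
      finally show ?thesis using True by simp
    next
      case False
      then show ?thesis using less[of "k - N"] shift[of "k - N"] N_pos by simp
    qed
  qed
qed

lemma shifted_sum_bound: "\<bar>\<Sum>n<k. \<psi> (n + m)\<bar> \<le> 2 * N"
proof -
  have "(\<Sum>n<m + k. \<psi> n) = (\<Sum>n<m. \<psi> n) + (\<Sum>n<k. \<psi> (n + m))"
    by (induction k) (simp_all add: add.commute)
  then show ?thesis using partial_sum_bound[of "m + k"] partial_sum_bound[of m] by linarith
qed

section \<open>Character sums with weights decreasing to zero\<close>

context
  fixes b :: "nat \<Rightarrow> real"
  assumes dec: "\<And>n. n \<ge> 1 \<Longrightarrow> b (Suc n) \<le> b n" and lim: "b \<longlonglongrightarrow> 0"
begin

text \<open>Index 0 is excluded because the weights to be used, \<open>real n powr -s\<close> and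
  \<open>monsky x n\<close>, evaluate to 0 there and decrease only from index 1 on.\<close>

lemma weight_nonneg: 
  assumes "n \<ge> 1"
  shows "b n \<ge> 0"
proof -
  have "decseq (\<lambda>k. b (k + n))" using assms by (intro decseq_SucI) (simp add: dec)
  moreover have "(\<lambda>k. b (k + n)) \<longlonglongrightarrow> 0" using lim by (rule LIMSEQ_ignore_initial_segment)
  ultimately show ?thesis using decseq_ge[of "\<lambda>k. b (k + n)" 0 0] by simp
qed

lemma weighted_sum_bound:
  assumes "m \<ge> 1"
  shows "\<bar>\<Sum>n<k. \<psi> (n + m) * b (n + m)\<bar> \<le> 2 * N * b m"
  using Abel_bound[of "\<lambda>n. \<psi> (n + m)" "2 * N" "\<lambda>n. b (n + m)" k] shifted_sum_bound
    dec weight_nonneg assms by simp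

text \<open>Dirichlet's test: a block starting at \<open>m\<close> is at most
  \<open>2 * N * b m\<close>, whatever its length.\<close>

lemma weighted_summable: "summable (\<lambda>n. \<psi> n * b n)"
  unfolding summable_Cauchy
proof (intro allI impI)
  fix e :: real assume e: "e > 0"
  have "(\<lambda>n. 2 * N * b n) \<longlonglongrightarrow> 0" by (intro tendsto_mult_right_zero lim)
  then have "eventually (\<lambda>n. 2 * N * b n < e) sequentially" 
    using e by (auto dest: order_tendstoD(2))
  then obtain m0 where m0: "\<And>m. m \<ge> m0 \<Longrightarrow> 2 * N * b m < e"
    by (auto simp: eventually_sequentially)
  have "norm (\<Sum>n=m..<k. \<psi> n * b n) < e" if "m \<ge> max m0 1" for m k
  proof -
    have "(\<Sum>n=m..<k. \<psi> n * b n) = (\<Sum>n<k-m. \<psi> (n + m) * b (n + m))"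
    proof (cases "m \<le> k")
      case True
      then show ?thesis
        using sum.shift_bounds_nat_ivl[of "\<lambda>n. \<psi> n * b n" 0 m "k - m"]
        by (simp add: atLeast0LessThan)
    qed simp
    then show ?thesis using weighted_sum_bound[of m "k-m"] m0[of m] that by simp
  qed
  then show "\<exists>M. \<forall>m\<ge>M. \<forall>k. norm (\<Sum>n=m..<k. \<psi> n * b n) < e" by blast
qed

text \<open>The explicit bound serves twice: for uniform convergence of the L-series, and with
  \<open>m = 1\<close> for the Monsky weights.\<close>

lemma weighted_tail_bound:
  assumes "m \<ge> 1"
  shows "\<bar>(\<Sum>n. \<psi> n * b n) - (\<Sum>n<m. \<psi> n * b n)\<bar> \<le> 2 * N * b m"
proof -
  have "(\<lambda>k. \<Sum>n<k. \<psi> (n + m) * b (n + m)) \<longlonglongrightarrow> (\<Sum>n. \<psi> (n + m) * b (n + m))"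
    using weighted_summable by (intro summable_LIMSEQ) (simp add: summable_iff_shift[of "\<lambda>n. \<psi> n * b n"])
  then have "\<bar>\<Sum>n. \<psi> (n + m) * b (n + m)\<bar> \<le> 2 * N * b m"
    by (intro LIMSEQ_le_const2[OF tendsto_rabs]) (use weighted_sum_bound assms in blast)+
  then show ?thesis
    using suminf_minus_initial_segment[OF weighted_summable, of m] by simp
qed

end

section \<open>The L-series on the half-line from 1\<close>

definition L :: "real \<Rightarrow> real" where
  "L s = (\<Sum>n. \<psi> n * real n powr -s)"

lemma powr_antimono: "s \<ge> 1 \<Longrightarrow> n \<ge> 1 \<Longrightarrow> real (Suc n) powr -s \<le> real n powr -s"
  by (intro powr_mono2') auto

lemma powr_tendsto_0: "s \<ge> 1 \<Longrightarrow> (\<lambda>n. real n powr -s) \<longlonglongrightarrow> 0"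
  by (rule tendsto_neg_powr) (auto simp: filterlim_real_sequentially)

lemma L_sums: "s \<ge> 1 \<Longrightarrow> (\<lambda>n. \<psi> n * real n powr -s) sums L s"
  unfolding L_def by (intro summable_sums weighted_summable powr_antimono powr_tendsto_0)

text \<open>Replacing \<open>s\<close> by 1 in the bound makes it independent of \<open>s\<close>;
  this uniformity carries continuity of \<open>L\<close> up to the endpoint 1.\<close>

lemma L_tail_bound:
  assumes "s \<ge> 1" "m \<ge> 1"
  shows "\<bar>L s - (\<Sum>n<m. \<psi> n * real n powr -s)\<bar> \<le> 2 * N * inverse (real m)"
proof -
  have "\<bar>L s - (\<Sum>n<m. \<psi> n * real n powr -s)\<bar> \<le> 2 * N * real m powr -s"
    unfolding L_def using assms by (intro weighted_tail_bound powr_antimono powr_tendsto_0)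
  also have "\<dots> \<le> 2 * N * real m powr -1"
    using assms by (intro mult_left_mono powr_mono) auto
  finally show ?thesis using assms by (simp add: powr_minus)
qed

lemma continuous_on_L: "continuous_on {1..} L"
proof (rule uniform_limit_theorem)
  show "uniform_limit {1..} (\<lambda>m s. \<Sum>n<m. \<psi> n * real n powr -s) L sequentially"
  proof (rule uniform_limitI)
    fix e :: real assume e: "e > 0"
    have "(\<lambda>m. 2 * N * inverse (real m)) \<longlonglongrightarrow> 0"
      by (intro tendsto_mult_right_zero lim_inverse_n)
    then have "eventually (\<lambda>m. 2 * N * inverse (real m) < e) sequentially"
      using e by (auto dest: order_tendstoD(2))
    then show "\<forall>\<^sub>F m in sequentially. \<forall>s\<in>{1..}. dist (\<Sum>n<m. \<psi> n * real n powr -s) (L s) < e"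
      using eventually_ge_at_top[of 1]
    proof eventually_elim
      case (elim m)
      show ?case
      proof
        fix s :: real assume "s \<in> {1..}"
        then show "dist (\<Sum>n<m. \<psi> n * real n powr -s) (L s) < e"
          using L_tail_bound[of s m] elim by (auto simp: dist_real_def abs_minus_commute)
      qed
    qed
  qed
  show "\<forall>\<^sub>F m in sequentially. continuous_on {1..} (\<lambda>s. \<Sum>n<m. \<psi> n * real n powr -s)"
  proof (intro always_eventually allI continuous_on_sum continuous_on_mult_left)
    fix n show "continuous_on {1..} (\<lambda>s. real n powr -s)"
      by (cases "n = 0") (auto intro!: continuous_intros)
  qed
qed auto

section \<open>Divisor sums of the character\<close>

definition divisor_sum :: "nat \<Rightarrow> real" where
  "divisor_sum k = (\<Sum>d | d dvd k. \<psi> d)"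

text \<open>Every divisor of \<open>p ^ a * m\<close> is uniquely \<open>p ^ i * d\<close> with
  \<open>i \<le> a\<close> and \<open>d\<close> dividing \<open>m\<close>.\<close>

lemma divisor_sum_prime_power_mult:
  assumes p: "prime p" and m: "\<not> p dvd m" "m > 0"
  shows "divisor_sum (p ^ a * m) = (\<Sum>i\<le>a. \<psi> p ^ i) * divisor_sum m"
proof -
  have "bij_betw (\<lambda>(i, d). p ^ i * d) ({..a} \<times> {d. d dvd m}) {d. d dvd p ^ a * m}"
    unfolding bij_betw_def
  proof
    show "inj_on (\<lambda>(i, d). p ^ i * d) ({..a} \<times> {d. d dvd m})"
    proof (rule inj_onI, clarsimp)
      fix i d j d' assume *: "d dvd m" "d' dvd m" "p ^ i * d = p ^ j * d'"
      have nd: "\<not> p dvd d" "\<not> p dvd d'" using * m by (auto dest: dvd_trans)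
      have "multiplicity p (p ^ i * d) = i" "multiplicity p (p ^ j * d') = j"
        using nd p by (auto intro!: multiplicity_eqI simp: prime_gt_0_nat)
      then have "i = j" using * by simp
      then show "i = j \<and> d = d'" using * p by (simp add: prime_gt_0_nat)
    qed
    show "(\<lambda>(i, d). p ^ i * d) ` ({..a} \<times> {d. d dvd m}) = {d. d dvd p ^ a * m}"
    proof safe
      fix i d assume "i \<le> a" "d dvd m"
      then show "p ^ i * d dvd p ^ a * m" by (intro mult_dvd_mono le_imp_power_dvd)
    next
      fix x assume "x dvd p ^ a * m"
      then obtain u v where uv: "x = u * v" "u dvd p ^ a" "v dvd m"
        using division_decomp by blast
      then obtain i where "i \<le> a" "u = p ^ i"
        using divides_primepow_nat[OF p] by blast
      with uv show "x \<in> (\<lambda>(i, d). p ^ i * d) ` ({..a} \<times> {d. d dvd m})"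
        by (auto intro!: image_eqI[of _ _ "(i, v)"])
    qed
  qed
  then have "divisor_sum (p ^ a * m) = (\<Sum>z\<in>{..a} \<times> {d. d dvd m}. \<psi> (case z of (i, d) \<Rightarrow> p ^ i * d))"
    unfolding divisor_sum_def by (rule sum.reindex_bij_betw[symmetric])
  also have "\<dots> = (\<Sum>(i, d)\<in>{..a} \<times> {d. d dvd m}. \<psi> p ^ i * \<psi> d)"
    by (intro sum.cong) (auto simp: mult power)
  also have "\<dots> = (\<Sum>i\<le>a. \<psi> p ^ i) * divisor_sum m"
    by (simp add: sum.cartesian_product[symmetric] divisor_sum_def sum_product)
  finally show ?thesis .
qed

text \<open>For the values -1, 0, 1 of \<open>\<psi> p\<close> the sum is an alternating sum, 1
  (from \<open>0 ^ 0\<close>), and \<open>a + 1\<close>.\<close>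

lemma sum_powers: "(\<Sum>i\<le>a. \<psi> p ^ i) \<ge> (if even a then 1 else 0)"
proof -
  consider "\<psi> p = -1" | "\<psi> p = 0" | "\<psi> p = 1" using vals[of p] by auto
  then show ?thesis
  proof cases
    case 1
    have "(\<Sum>i\<le>a. (-1::real) ^ i) = (if even a then 1 else 0)" by (induction a) auto
    with 1 show ?thesis by simp
  next
    case 2
    have "(\<Sum>i\<le>a. (0::real) ^ i) = 1" by (induction a) auto
    with 2 show ?thesis by simp
  qed auto
qed

text \<open>Strong induction, splitting off the full power of one prime: a square has only even
  exponents, and \<open>sum_powers\<close> bounds each prime's factor.\<close>

lemma divisor_sum_lower_bound: "k > 0 \<Longrightarrow> divisor_sum k \<ge> (if is_nth_power 2 k then 1 else 0)"
proof (induction k rule: less_induct)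
  case (less k)
  show ?case
  proof (cases "k = 1")
    case True
    then show ?thesis by (simp add: divisor_sum_def one)
  next
    case False
    then obtain p where p: "prime p" "p dvd k" using prime_factor_nat by blast
    define a where "a = multiplicity p k"
    obtain m where m: "k = p ^ a * m" "\<not> p dvd m"
      using less.prems p multiplicity_decompose'[of k p] unfolding a_def
      by (metis not_prime_unit less_irrefl)
    have "a > 0" using p less.prems unfolding a_def by (simp add: prime_multiplicity_gt_zero_iff)
    have "m > 0" using m less.prems by (auto intro: Nat.gr0I)
    have "p ^ a > 1" using p \<open>a > 0\<close> prime_gt_1_nat by (intro one_less_power) auto
    then have "m < k" using m \<open>m > 0\<close> by simp
    have "coprime (p ^ a) m" using p m by (simp add: prime_imp_coprime)
    then have sq: "is_nth_power 2 k \<longleftrightarrow> even a \<and> is_nth_power 2 m"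
      unfolding m(1) using p
      by (simp add: is_nth_power_mult_coprime_nat_iff is_nth_power_prime_power_nat_iff)
    have "(if is_nth_power 2 k then 1 else 0) = 
      (if even a then 1 else (0::real)) * (if is_nth_power 2 m then 1 else 0)"
      by (simp add: sq)
    also have "\<dots> \<le> (\<Sum>i\<le>a. \<psi> p ^ i) * divisor_sum m"
      using less.IH[OF \<open>m < k\<close> \<open>m > 0\<close>] sum_powers[of a p]
      by (intro mult_mono) (auto split: if_splits)
    finally show ?thesis using divisor_sum_prime_power_mult[OF p(1) m(2) \<open>m > 0\<close>] m(1) by simp
  qed
qed

text \<open>A truncated Lambert series: put \<open>k = n * m\<close> and exchange the order of
  summation.\<close>

lemma sum_divisor_sum_power:
  "(\<Sum>k=1..M. divisor_sum k * x ^ k) = (\<Sum>n=1..M. \<psi> n * (\<Sum>m=1..M div n. (x ^ n) ^ m))"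
proof -
  have le: "b \<le> M" if "Suc 0 \<le> k" "b * k \<le> M" for b k
    using that le_trans[of b "b * k" M] by simp
  have "(\<Sum>n=1..M. \<psi> n * (\<Sum>m=1..M div n. (x ^ n) ^ m)) =
        (\<Sum>(n, m)\<in>(SIGMA n:{1..M}. {1..M div n}). \<psi> n * x ^ (n * m))"
    by (simp add: sum.Sigma[symmetric] sum_distrib_left power_mult)
  also have "\<dots> = (\<Sum>(k, d)\<in>(SIGMA k:{1..M}. {d. d dvd k}). \<psi> d * x ^ k)"
    by (rule sum.reindex_bij_witness[of _ "\<lambda>(k, d). (d, k div d)" "\<lambda>(n, m). (n * m, n)"])
      (auto simp: less_eq_div_iff_mult_less_eq mult.commute div_le_mono dvd_imp_le
        intro!: Suc_leI Nat.gr0I elim!: dvdE, metis le)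
  also have "\<dots> = (\<Sum>k=1..M. divisor_sum k * x ^ k)"
    by (subst sum.Sigma[symmetric]) (auto simp: divisor_sum_def sum_distrib_right)
  finally show ?thesis by simp
qed


text \<open>If \<open>L 1 = 0\<close>, the terms at the first \<open>J\<close> squares add up to at
  most \<open>2 * N\<close> for every \<open>x\<close> in (0, 1). Letting \<open>x\<close> tend to 1
  gives \<open>J \<le> 2 * N\<close>, which fails for \<open>J = 2 * N + 1\<close>.\<close>

lemma L_1_nonzero: "L 1 \<noteq> 0"
proof
  assume L1: "L 1 = 0"
  have bound: "(\<Sum>j=1..J. x ^ (j\<^sup>2)) \<le> 2 * N" if x: "0 < x" "x < 1" for x :: real and J :: nat
  proof -
    define F where "F = (\<lambda>n. \<psi> n * (x ^ n / (1 - x ^ n)))"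
    have lim: "(\<lambda>n. \<psi> n * monsky x n) sums (\<Sum>n. \<psi> n * monsky x n)"
      by (intro summable_sums weighted_summable monsky_antimono monsky_tendsto_0 x)
    have "\<bar>\<Sum>n. \<psi> n * monsky x n\<bar> \<le> 2 * N * monsky x 1"
      using weighted_tail_bound[of "monsky x" 1] monsky_antimono[OF x] monsky_tendsto_0[OF x]
      by (simp add: zero)
    also have "monsky x 1 = 1" using x by (simp add: monsky_def field_simps)
    finally have bd: "\<bar>\<Sum>n. \<psi> n * monsky x n\<bar> \<le> 2 * N" by simp
    \<comment> \<open>Because \<open>L 1 = 0\<close>, the part \<open>1 / (n * (1 - x))\<close> of
      the weights sums to 0 against \<open>\<psi>\<close>; removing it leaves the Lambert series
      \<open>F\<close>.\<close>
    have "(\<lambda>n. (1 / (1 - x)) * (\<psi> n * real n powr -1)) sums (1 / (1 - x) * L 1)"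
      by (intro sums_mult L_sums) simp
    from sums_diff[OF this lim]
    have "(\<lambda>n. 1 / (1 - x) * (\<psi> n * real n powr -1) - \<psi> n * monsky x n)
            sums (- (\<Sum>n. \<psi> n * monsky x n))"
      by (simp add: L1)
    also have "(\<lambda>n. 1 / (1 - x) * (\<psi> n * real n powr - 1) - \<psi> n * monsky x n) = F"
    proof
      fix n
      show "1 / (1 - x) * (\<psi> n * real n powr - 1) - \<psi> n * monsky x n = F n"
        by (cases "n = 0") (use x in \<open>simp_all add: zero F_def monsky_def powr_minus inverse_eq_divide right_diff_distrib[of "\<psi> n"]\<close>)
    qed
    finally have "(\<lambda>M. \<Sum>n\<le>M. F n) \<longlonglongrightarrow> - (\<Sum>n. \<psi> n * monsky x n)"
      by (simp add: sums_def_le)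
    moreover have "(\<Sum>n\<le>M. F n) = (\<Sum>n=1..M. F n)" for M
      by (rule sum.mono_neutral_right) (auto simp: F_def zero not_less_eq_eq)
    ultimately have F: "(\<lambda>M. \<Sum>n=1..M. F n) \<longlonglongrightarrow> - (\<Sum>n. \<psi> n * monsky x n)" by simp

    \<comment> \<open>The truncated divisor sums use only \<open>n * m \<le> M\<close>, whereas
      \<open>F n\<close> is a full geometric series. Each omitted tail starts beyond exponent
      \<open>M\<close>, hence is at most \<open>x ^ M / (1 - x)\<close>, and there are
      \<open>M\<close> of them.\<close>
    have diff: "\<bar>(\<Sum>k=1..M. divisor_sum k * x ^ k) - (\<Sum>n=1..M. F n)\<bar> \<le> real M * x ^ M / (1 - x)" for M
    proof -
      have "\<bar>\<psi> n * (\<Sum>m=1..M div n. (x ^ n) ^ m) - F n\<bar> \<le> x ^ M / (1 - x)" if n: "n \<in> {1..M}" for n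
      proof -
        define y where "y = x ^ n"
        have "y \<le> x ^ 1" unfolding y_def using x n by (intro power_decreasing) auto
        then have y: "0 < y" "y < 1" "1 - x \<le> 1 - y" using x by (auto simp: y_def)
        have "(\<Sum>m=1..M div n. y ^ m) = (y - y ^ Suc (M div n)) / (1 - y)"
          using sum_gp[of y 1 "M div n"] y n by (auto simp: not_less div_greater_zero_iff)
        then have "\<psi> n * (\<Sum>m=1..M div n. y ^ m) - F n = - (\<psi> n * (y ^ Suc (M div n) / (1 - y)))"
          unfolding F_def y_def[symmetric] by (simp add: diff_divide_distrib right_diff_distrib)
        then have "\<bar>\<psi> n * (\<Sum>m=1..M div n. y ^ m) - F n\<bar> = \<bar>\<psi> n\<bar> * (y ^ Suc (M div n) / (1 - y))"
          using y by (simp add: abs_mult)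
        also have "\<dots> \<le> 1 * (x ^ M / (1 - x))"
        proof (intro mult_mono abs_le_1 frac_le)
          have "M = n * (M div n) + M mod n" by simp
          moreover have "M mod n < n" using n by simp
          ultimately have "M \<le> n * Suc (M div n)" by (metis add_le_cancel_left less_imp_le_nat mult_Suc_right add.commute)
          then show "y ^ Suc (M div n) \<le> x ^ M"
            unfolding y_def power_mult[symmetric] using x by (intro power_decreasing) auto
        qed (use x y in auto)
        finally show ?thesis by (simp add: y_def)
      qed
      then have "(\<Sum>n=1..M. \<bar>\<psi> n * (\<Sum>m=1..M div n. (x ^ n) ^ m) - F n\<bar>) \<le> (\<Sum>n=1..M. x ^ M / (1 - x))"
        by (intro sum_mono)
      then show ?thesis
        unfolding sum_divisor_sum_power sum_subtractf[symmetric] by (intro order_trans[OF sum_abs]) simp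
    qed
    have "(\<lambda>M. real M * x ^ M / (1 - x)) \<longlonglongrightarrow> 0"
      using x by (intro tendsto_divide_zero powser_times_n_limit_0) auto
    then have "(\<lambda>M. (\<Sum>k=1..M. divisor_sum k * x ^ k) - (\<Sum>n=1..M. F n)) \<longlonglongrightarrow> 0"
      by (rule Lim_null_comparison[rotated]) (simp only: real_norm_def diff eventually_True)
    from tendsto_add[OF this F]
    have "(\<lambda>M. \<Sum>k=1..M. divisor_sum k * x ^ k) \<longlonglongrightarrow> - (\<Sum>n. \<psi> n * monsky x n)" by simp
    \<comment> \<open>Only square indices are kept: the coefficients there are at least 1, and all
      others are nonnegative.\<close>
    moreover have "(\<Sum>j=1..J. x ^ (j\<^sup>2)) \<le> (\<Sum>k=1..M. divisor_sum k * x ^ k)" if "M \<ge> J\<^sup>2" for M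
    proof -
      have "(\<Sum>j=1..J. x ^ (j\<^sup>2)) = (\<Sum>k\<in>(\<lambda>j. j\<^sup>2) ` {1..J}. x ^ k)"
        by (subst sum.reindex) (auto simp: inj_on_def)
      also have "\<dots> \<le> (\<Sum>k\<in>(\<lambda>j. j\<^sup>2) ` {1..J}. divisor_sum k * x ^ k)"
      proof (rule sum_mono)
        fix k assume "k \<in> (\<lambda>j. j\<^sup>2) ` {1..J}"
        then have "divisor_sum k \<ge> 1" using divisor_sum_lower_bound[of k] by auto
        then show "x ^ k \<le> divisor_sum k * x ^ k" using x by simp
      qed
      also have "\<dots> \<le> (\<Sum>k=1..M. divisor_sum k * x ^ k)"
      proof (rule sum_mono2)
        show "(\<lambda>j. j\<^sup>2) ` {1..J} \<subseteq> {1..M}"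
          using that by (auto intro: le_trans[OF power_mono[of _ J 2]])
        fix k assume "k \<in> {1..M} - (\<lambda>j. j\<^sup>2) ` {1..J}"
        then have "divisor_sum k \<ge> 0" using divisor_sum_lower_bound[of k] by (auto split: if_splits)
        then show "0 \<le> divisor_sum k * x ^ k" using x by simp
      qed auto
      finally show ?thesis .
    qed
    ultimately have "(\<Sum>j=1..J. x ^ (j\<^sup>2)) \<le> - (\<Sum>n. \<psi> n * monsky x n)"
      by (intro LIMSEQ_le_const) blast+
    then show ?thesis using bd by linarith
  qed
  define J where "J = 2 * N + 1"
  have "((\<lambda>x::real. \<Sum>j=1..J. x ^ (j\<^sup>2)) \<longlongrightarrow> (\<Sum>j=1..J. 1 ^ (j\<^sup>2))) (at_left 1)"
    by (intro tendsto_intros)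
  moreover have "eventually (\<lambda>x::real. (\<Sum>j=1..J. x ^ (j\<^sup>2)) \<le> 2 * N) (at_left 1)"
    using eventually_at_left_real[of 0 1] by (rule eventually_mono) (use bound in auto)
  ultimately have "(\<Sum>j=1..J. 1 ^ (j\<^sup>2)) \<le> (2 * N :: real)"
    by (intro tendsto_upperbound) auto
  then show False by (simp add: J_def)
qed

end

section \<open>Euler products and sums over primes\<close>

text \<open>A sieve: the terms at multiples of \<open>p\<close> sum to \<open>f p\<close> times the
  whole, so the factor \<open>1 - f p\<close> removes them.\<close>

lemma infsum_Euler:
  fixes f :: "nat \<Rightarrow> real"
  assumes mult: "\<And>m n. f (m * n) = f m * f n"
    and summable: "f summable_on UNIV"
    and A: "finite A" "\<And>p. p \<in> A \<Longrightarrow> prime p"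
  shows "(\<Prod>p\<in>A. 1 - f p) * infsum f UNIV = infsum f {n. \<forall>p\<in>A. \<not> p dvd n}"
  using A
proof (induction A rule: finite_induct)
  case (insert p A)
  define B where "B = {n. \<forall>q\<in>A. \<not> q dvd n}"
  have p: "prime p" "p > 0" using insert by (auto simp: prime_gt_0_nat)
  have sub: "f summable_on C" for C using summable by (rule summable_on_subset_banach) auto
  \<comment> \<open>As \<open>p\<close> lies outside \<open>A\<close>, multiplying or dividing by
    \<open>p\<close> does not affect divisibility by the primes of \<open>A\<close>.\<close>
  have C: "(\<lambda>n. p * n) ` B = {n \<in> B. p dvd n}"
  proof safe
    fix n assume "n \<in> B"
    then show "p * n \<in> B"
      unfolding B_def using insert.hyps insert.prems p primes_dvd_imp_eq[of _ p]
      by (auto simp: prime_dvd_mult_iff)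
  next
    fix n assume "n \<in> B" "p dvd n"
    then obtain k where "n = p * k" by (auto elim: dvdE)
    then show "n \<in> (\<lambda>n. p * n) ` B" using \<open>n \<in> B\<close>
      by (intro image_eqI[of _ _ k]) (auto simp: B_def)
  qed auto
  have "infsum f ((\<lambda>n. p * n) ` B) = infsum (f \<circ> (\<lambda>n. p * n)) B"
    by (rule infsum_reindex) (use p in \<open>auto simp: inj_on_def\<close>)
  also have "\<dots> = f p * infsum f B"
    by (simp add: o_def mult infsum_cmult_right')
  finally have "infsum f {n \<in> B. p dvd n} = f p * infsum f B" by (simp add: C)
  moreover have "infsum f (B - {n \<in> B. p dvd n}) = infsum f B - infsum f {n \<in> B. p dvd n}"
    by (rule infsum_Diff) (auto intro: sub)
  moreover have "B - {n \<in> B. p dvd n} = {n. \<forall>q\<in>insert p A. \<not> q dvd n}"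
    by (auto simp: B_def)
  ultimately have "infsum f {n. \<forall>q\<in>insert p A. \<not> q dvd n} = (1 - f p) * infsum f B"
    by (simp add: algebra_simps)
  then show ?case using insert by (simp add: B_def)
qed simp

section \<open>Prime sums as logarithms of Dirichlet series\<close>

definition prime_sum :: "(nat \<Rightarrow> real) \<Rightarrow> real" where
  "prime_sum f = (\<Sum>n. if prime n then f n else 0)"

lemma prime_sum_sums:
  fixes f :: "nat \<Rightarrow> real"
  assumes "summable (\<lambda>n. \<bar>f n\<bar>)"
  shows "(\<lambda>n. if prime n then f n else 0) sums prime_sum f"
  unfolding prime_sum_def
  by (intro summable_sums summable_comparison_test'[OF assms]) auto

text \<open>After sieving by all primes below \<open>X\<close>, the only term left below
  \<open>X\<close> is \<open>f 1\<close>, and the rest is dominated by a tail. The form without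
  division lets the nonvanishing of \<open>suminf f\<close> be deduced from it.\<close>

lemma Euler_product:
  fixes f :: "nat \<Rightarrow> real"
  assumes mult: "\<And>m n. f (m * n) = f m * f n" and f1: "f 1 = 1" and f0: "f 0 = 0"
    and summable: "summable (\<lambda>n. \<bar>f n\<bar>)"
  shows "(\<lambda>X. (\<Prod>p | prime p \<and> p < X. 1 - f p) * suminf f) \<longlonglongrightarrow> 1"
proof -
  have on: "f summable_on UNIV"
    using summable by (intro norm_summable_imp_summable_on) simp
  have "suminf f = infsum f UNIV"
    using has_sum_imp_sums[OF has_sum_infsum[OF on]] by (simp add: sums_iff)
  define U where "U = (\<lambda>X::nat. {n::nat. \<forall>p\<in>{p. prime p \<and> p < X}. \<not> p dvd n})"
  have prod: "(\<Prod>p | prime p \<and> p < X. 1 - f p) * suminf f = infsum f (U X)" for X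
    unfolding U_def \<open>suminf f = _\<close>
    by (rule infsum_Euler[OF mult on]) (auto intro: finite_subset[of _ "{..<X}"])
  have fU: "\<bar>infsum f (U X) - 1\<bar> \<le> (\<Sum>n. \<bar>f (n + X)\<bar>)" if "X > 2" for X
  proof -
    have "(f has_sum infsum f (U X)) (U X)"
      using on by (intro has_sum_infsum summable_on_subset_banach[OF on]) auto
    then have "((\<lambda>n. if n \<in> U X then f n else 0) has_sum infsum f (U X)) UNIV"
      by (rule has_sum_cong_neutral[THEN iffD1, rotated -1]) auto
    then have s: "(\<lambda>n. if n \<in> U X then f n else 0) sums infsum f (U X)" (is "?g sums _")
      by (rule has_sum_imp_sums)
    have "(\<Sum>n<X. ?g n) = (\<Sum>n\<in>{1}. f n)"
    proof (rule sum.mono_neutral_cong_right)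
      show "\<forall>i\<in>{..<X} - {1}. ?g i = 0"
      proof
        fix i assume i: "i \<in> {..<X} - {1}"
        show "?g i = 0"
        proof (cases "i = 0")
          case False
          then obtain p where "prime p" "p dvd i" using i prime_factor_nat by blast
          then have "i \<notin> U X" using i False dvd_imp_le[of p i] by (auto simp: U_def)
          then show ?thesis by simp
        qed (simp add: f0)
      qed
    qed (use that in \<open>auto simp: U_def\<close>)
    then have "infsum f (U X) - 1 = (\<Sum>n. ?g (n + X))"
      using suminf_minus_initial_segment[of ?g X] s f1 by (simp add: sums_iff)
    also have "\<bar>\<dots>\<bar> \<le> (\<Sum>n. \<bar>?g (n + X)\<bar>)"
    proof (rule summable_rabs)
      show "summable (\<lambda>n. \<bar>?g (n + X)\<bar>)"
        by (rule summable_comparison_test'[OF summable_ignore_initial_segment[OF summable, of X]]) auto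
    qed
    also have "\<dots> \<le> (\<Sum>n. \<bar>f (n + X)\<bar>)"
    proof (rule suminf_le)
      show "summable (\<lambda>n. \<bar>?g (n + X)\<bar>)"
        by (rule summable_comparison_test'[OF summable_ignore_initial_segment[OF summable, of X]]) auto
    qed (auto intro: summable_ignore_initial_segment[OF summable])
    finally show ?thesis .
  qed
  have "(\<lambda>X. \<Sum>n. \<bar>f (n + X)\<bar>) \<longlonglongrightarrow> 0"
    using suminf_exist_split2[OF summable] by simp
  then have "(\<lambda>X. infsum f (U X) - 1) \<longlonglongrightarrow> 0"
    by (rule Lim_null_comparison[rotated])
      (use fU in \<open>auto intro!: eventually_mono[OF eventually_gt_at_top[of 2]]\<close>)
  then show ?thesis unfolding prod by (simp add: LIM_zero_iff)
qed

text \<open>Dominates the sum over primes of \<open>\<bar>f p + ln (1 - f p)\<bar>\<close>, each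
  term being at most \<open>2 * (f p)\<^sup>2\<close>.\<close>

definition log_error :: real where
  "log_error = (\<Sum>n. 2 * inverse (real n ^ 2))"

text \<open>Logarithm of the Euler product, with \<open>ln (1 - f p)\<close> replaced by
  \<open>- f p\<close>. The error does not depend on \<open>f\<close>, hence stays bounded as
  \<open>s\<close> tends to 1.\<close>

lemma prime_sum_ln:
  fixes f :: "nat \<Rightarrow> real"
  assumes mult: "\<And>m n. f (m * n) = f m * f n" and f1: "f 1 = 1" and f0: "f 0 = 0"
    and summable: "summable (\<lambda>n. \<bar>f n\<bar>)" and bound: "\<And>n. \<bar>f n\<bar> \<le> inverse (real n)"
  shows "suminf f > 0" "\<bar>prime_sum f - ln (suminf f)\<bar> \<le> log_error"
proof -
  define P where "P = (\<lambda>X. {p::nat. prime p \<and> p < X})"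
  have fin [simp]: "finite (P X)" for X
    unfolding P_def by (auto intro: finite_subset[of _ "{..<X}"])
  define E where "E = (\<lambda>X. \<Prod>p\<in>P X. 1 - f p)"
  \<comment> \<open>The bound 1/2 keeps \<open>1 - f p\<close> positive and within the range of the
    quadratic estimate for the logarithm.\<close>
  have fp: "\<bar>f p\<bar> \<le> 1 / 2" if "prime p" for p
  proof -
    have "inverse (real p) \<le> inverse 2"
      using prime_ge_2_nat[OF that] by (intro le_imp_inverse_le) auto
    then show ?thesis using bound[of p] by simp
  qed
  have pos: "1 - f p > 0" if "prime p" for p using fp[OF that] by linarith
  have E_pos: "E X > 0" for X
    unfolding E_def using pos by (intro prod_pos) (auto simp: P_def)
  have lim: "(\<lambda>X. E X * suminf f) \<longlonglongrightarrow> 1"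
    unfolding E_def P_def by (rule Euler_product[OF mult f1 f0 summable])
  have "suminf f \<noteq> 0"
  proof
    assume "suminf f = 0"
    then have "(\<lambda>X. 0::real) \<longlonglongrightarrow> 1" using lim by simp
    then show False by (simp add: LIMSEQ_const_iff)
  qed
  moreover have "\<not> suminf f < 0"
  proof
    assume "suminf f < 0"
    then have "E X * suminf f \<le> 0" for X using E_pos[of X] by (simp add: mult_le_0_iff)
    then have "(1::real) \<le> 0" by (intro LIMSEQ_le_const2[OF lim]) auto
    then show False by simp
  qed
  ultimately show Z: "suminf f > 0" by linarith
  have "(\<lambda>X. ln (E X * suminf f)) \<longlonglongrightarrow> ln 1"
    by (intro tendsto_ln lim) auto
  moreover have "ln (E X * suminf f) = (\<Sum>p\<in>P X. ln (1 - f p)) + ln (suminf f)" for X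
  proof -
    have "1 - f p \<noteq> 0" if "p \<in> P X" for p
      using pos[of p] that unfolding P_def by force
    then have "ln (E X) = (\<Sum>p\<in>P X. ln (1 - f p))"
      unfolding E_def by (intro ln_prod fin)
    then show ?thesis using E_pos[of X] Z by (simp add: ln_mult)
  qed
  ultimately have lnlim: "(\<lambda>X. (\<Sum>p\<in>P X. ln (1 - f p)) + ln (suminf f)) \<longlonglongrightarrow> 0" by simp
  have "(\<Sum>n<X. if prime n then f n else 0) = (\<Sum>p\<in>P X. f p)" for X
    by (rule sum.mono_neutral_cong_right) (auto simp: P_def)
  then have "(\<lambda>X. \<Sum>p\<in>P X. f p) \<longlonglongrightarrow> prime_sum f"
    using prime_sum_sums[OF summable] by (simp add: sums_def)
  from tendsto_diff[OF tendsto_add[OF this lnlim] tendsto_const[of "ln (suminf f)"]]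
  have *: "(\<lambda>X. (\<Sum>p\<in>P X. f p) + (\<Sum>p\<in>P X. ln (1 - f p))) \<longlonglongrightarrow> prime_sum f - ln (suminf f)"
    by (simp add: algebra_simps)
  have "\<bar>(\<Sum>p\<in>P X. f p) + (\<Sum>p\<in>P X. ln (1 - f p))\<bar> \<le> log_error" for X
  proof -
    have "\<bar>(\<Sum>p\<in>P X. f p) + (\<Sum>p\<in>P X. ln (1 - f p))\<bar> \<le> (\<Sum>p\<in>P X. \<bar>f p + ln (1 - f p)\<bar>)"
      unfolding sum.distrib[symmetric] by (rule sum_abs)
    also have "\<dots> \<le> (\<Sum>p\<in>P X. 2 * inverse (real p ^ 2))"
    proof (rule sum_mono)
      fix p assume "p \<in> P X"
      then have "\<bar>ln (1 + - f p) - - f p\<bar> \<le> 2 * (- f p)\<^sup>2"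
        using fp[of p] by (intro abs_ln_one_plus_x_minus_x_bound) (auto simp: P_def)
      also have "\<dots> \<le> 2 * (inverse (real p))\<^sup>2"
        using bound[of p] by (auto simp: abs_le_square_iff[symmetric])
      finally show "\<bar>f p + ln (1 - f p)\<bar> \<le> 2 * inverse (real p ^ 2)"
        by (simp add: power_inverse add.commute)
    qed
    also have "\<dots> \<le> log_error"
      unfolding log_error_def by (intro sum_le_suminf summable_mult inverse_power_summable) auto
    finally show ?thesis .
  qed
  then show "\<bar>prime_sum f - ln (suminf f)\<bar> \<le> log_error"
    by (intro LIMSEQ_le_const2[OF tendsto_rabs[OF *]]) auto
qed

text \<open>The prime sum stays within \<open>log_error\<close> of \<open>ln (L s)\<close>, which
  converges since \<open>L\<close> is continuous and \<open>L 1\<close> is nonzero.\<close>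

lemma (in real_character) prime_sum_bounded:
  "\<exists>B. eventually (\<lambda>s. \<bar>prime_sum (\<lambda>n. \<psi> n * real n powr -s)\<bar> \<le> B) (at_right 1)"
proof -
  have *: "L s > 0 \<and> \<bar>prime_sum (\<lambda>n. \<psi> n * real n powr -s) - ln (L s)\<bar> \<le> log_error" if s: "s > 1" for s
  proof -
    have "summable (\<lambda>n. \<bar>\<psi> n * real n powr -s\<bar>)"
      by (rule summable_comparison_test'[OF summable_powr_uminus[OF s]])
        (auto simp: abs_mult intro!: mult_left_le_one_le abs_le_1)
    moreover have "\<bar>\<psi> n * real n powr -s\<bar> \<le> inverse (real n)" for n
    proof (cases "n = 0")
      case False
      have "\<bar>\<psi> n * real n powr -s\<bar> \<le> 1 * real n powr -1"
        unfolding abs_mult abs_of_nonneg[OF powr_ge_zero] using s False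
        by (intro mult_mono abs_le_1 powr_mono) auto
      then show ?thesis using False by (simp add: powr_minus)
    qed simp
    ultimately show ?thesis
      using prime_sum_ln[of "\<lambda>n. \<psi> n * real n powr -s"]
      by (simp add: mult powr_mult one L_def mult_ac)
  qed
  have "(L \<longlongrightarrow> L 1) (at_right 1)"
    using continuous_on_L unfolding continuous_on_def
    by (auto intro: tendsto_within_subset)
  moreover have "L 1 \<ge> 0"
    using calculation by (rule tendsto_lowerbound)
      (use * in \<open>auto intro!: eventually_mono[OF eventually_at_right_less] less_imp_le\<close>)
  ultimately have "((\<lambda>s. ln (L s)) \<longlongrightarrow> ln (L 1)) (at_right 1)"
    using L_1_nonzero by (intro tendsto_ln)
  then have "((\<lambda>s. \<bar>ln (L s)\<bar>) \<longlongrightarrow> \<bar>ln (L 1)\<bar>) (at_right 1)" by (rule tendsto_rabs)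
  then have "eventually (\<lambda>s. \<bar>ln (L s)\<bar> < \<bar>ln (L 1)\<bar> + 1) (at_right 1)"
    by (rule order_tendstoD) simp
  then have "eventually (\<lambda>s. \<bar>prime_sum (\<lambda>n. \<psi> n * real n powr -s)\<bar> \<le> \<bar>ln (L 1)\<bar> + 1 + log_error) (at_right 1)"
    using eventually_at_right_less[of 1] by eventually_elim (use * in fastforce)
  then show ?thesis by blast
qed

lemma prime_sum_powr_at_top:
  "filterlim (\<lambda>s. prime_sum (\<lambda>n. real n powr -s)) at_top (at_right 1)"
  unfolding filterlim_at_top
proof
  fix B :: real
  have "\<not> summable (\<lambda>n. inverse (real n))" by (rule not_summable_harmonic)
  \<comment> \<open>The zeta sum will exceed this threshold near 1; its logarithm then exceeds
    \<open>B\<close> even after losing \<open>log_error\<close>.\<close>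
  then obtain K where K: "(\<Sum>n<K. inverse (real n)) > exp (B + log_error)"
    using bounded_imp_summable[of "\<lambda>n. inverse (real n)" "exp (B + log_error)"] 
    by (metis inverse_nonnegative_iff_nonnegative of_nat_0_le_iff lessThan_Suc_atMost not_le)
  have "((\<lambda>s. \<Sum>n<K. real n powr -s) \<longlongrightarrow> (\<Sum>n<K. real n powr -1)) (at_right 1)"
  proof (rule tendsto_sum)
    fix n show "((\<lambda>s. real n powr -s) \<longlongrightarrow> real n powr -1) (at_right 1)"
    proof (cases "n = 0")
      case False
      then show ?thesis by (intro tendsto_intros) auto
    qed simp
  qed
  moreover have "(\<Sum>n<K. real n powr -1) > exp (B + log_error)"
    using K by (simp add: powr_minus)
  ultimately have "eventually (\<lambda>s. (\<Sum>n<K. real n powr -s) > exp (B + log_error)) (at_right 1)"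
    by (rule order_tendstoD)
  then show "eventually (\<lambda>s. B \<le> prime_sum (\<lambda>n. real n powr -s)) (at_right 1)"
    using eventually_at_right_less[of 1]
  proof eventually_elim
    case (elim s)
    have sum: "summable (\<lambda>n. real n powr -s)" by (rule summable_powr_uminus) (use elim in auto)
    have "\<bar>real n powr -s\<bar> \<le> inverse (real n)" for n
    proof (cases "n = 0")
      case False
      have "real n powr -s \<le> real n powr -1" using elim False by (intro powr_mono) auto
      then show ?thesis using False by (simp add: powr_minus)
    qed simp
    then have Z: "(\<Sum>n. real n powr -s) > 0" 
      "\<bar>prime_sum (\<lambda>n. real n powr -s) - ln (\<Sum>n. real n powr -s)\<bar> \<le> log_error"
      using prime_sum_ln[of "\<lambda>n. real n powr -s"] sum by (simp_all add: powr_mult)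
    have "(\<Sum>n<K. real n powr -s) \<le> (\<Sum>n. real n powr -s)"
      by (intro sum_le_suminf sum) auto
    then have "exp (B + log_error) \<le> (\<Sum>n. real n powr -s)" using elim by linarith
    then have "B + log_error \<le> ln (\<Sum>n. real n powr -s)" using Z(1) by (simp add: ln_ge_iff)
    then show ?case using Z(2) by linarith
  qed
qed

section \<open>Primes with prescribed non-residues\<close>

lemma real_character_jacobi_char:
  assumes "M > 0" "d dvd M" "\<not> is_nth_power 2 d"
  shows "real_character (jacobi_char M d) (8 * M)"
proof
  show "jacobi_char M d 0 = 0" using assms by (simp add: jacobi_char_def)
qed (use assms jacobi_char_mult jacobi_char_1 jacobi_char_values jacobi_char_add_period jacobi_char_sum_period in auto)

lemma summable_jacobi_char:
  assumes "M > 0" "d dvd M" "s > 1"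
  shows "summable (\<lambda>n. \<bar>jacobi_char M d n * real n powr -s\<bar>)"
proof (rule summable_comparison_test'[OF summable_powr_uminus[OF assms(3)]])
  fix n :: nat
  show "norm \<bar>jacobi_char M d n * real n powr -s\<bar> \<le> real n powr -s"
    using jacobi_char_values[OF assms(1,2), of n] by auto
qed

text \<open>The principal character differs from 1 on primes only at the divisors of
  \<open>2 * M\<close>: finitely many terms, each at most 1.\<close>

lemma prime_sum_jacobi_char_1_at_top:
  assumes "M > 0"
  shows "filterlim (\<lambda>s. prime_sum (\<lambda>n. jacobi_char M 1 n * real n powr -s)) at_top (at_right 1)"
proof (rule filterlim_at_top_mono)
  define Q where "Q = prime_factors (2 * M)"
  show "filterlim (\<lambda>s. - real (card Q) + prime_sum (\<lambda>n. real n powr -s)) at_top (at_right 1)"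
    by (intro filterlim_tendsto_add_at_top[OF tendsto_const] prime_sum_powr_at_top)
  show "eventually (\<lambda>s. - real (card Q) + prime_sum (\<lambda>n. real n powr -s)
          \<le> prime_sum (\<lambda>n. jacobi_char M 1 n * real n powr -s)) (at_right 1)"
    using eventually_at_right_less[of 1]
  proof eventually_elim
    case (elim s)
    define g where "g = (\<lambda>n. (if prime n then real n powr -s else 0) -
        (if prime n then jacobi_char M 1 n * real n powr -s else 0))"
    have "g sums (prime_sum (\<lambda>n. real n powr -s) - prime_sum (\<lambda>n. jacobi_char M 1 n * real n powr -s))"
      unfolding g_def using elim assms
      by (intro sums_diff prime_sum_sums summable_jacobi_char) (auto intro: summable_powr_uminus)
    moreover have "g n = 0" if "n \<notin> Q" for n
    proof (cases "prime n")
      case True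
      then have "\<not> n dvd 2 * M" using that assms by (auto simp: Q_def in_prime_factors_iff)
      then have "coprime n (2 * M)" using True prime_imp_coprime by blast
      then show ?thesis by (simp add: g_def jacobi_char_def)
    qed (simp add: g_def)
    then have "g sums sum g Q" by (intro sums_finite) (auto simp: Q_def)
    ultimately have eq: "prime_sum (\<lambda>n. real n powr -s) - prime_sum (\<lambda>n. jacobi_char M 1 n * real n powr -s) = sum g Q"
      by (rule sums_unique2)
    have "sum g Q \<le> (\<Sum>n\<in>Q. 1)"
    proof (rule sum_mono)
      fix n assume "n \<in> Q"
      then have n: "prime n" "n > 0" by (auto simp: Q_def in_prime_factors_iff prime_gt_0_nat)
      have "real n powr -s \<le> real n powr 0" using elim n by (intro powr_mono) auto
      then show "g n \<le> 1" using n by (auto simp: g_def jacobi_char_def)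
    qed
    then show ?case using eq by simp
  qed
qed

text \<open>Here \<open>k\<close> stands for the size of a subset with product \<open>d\<close>. A
  square \<open>d\<close> forces \<open>k\<close> even, so the terms are nonnegative; otherwise
  nonvanishing at 1 gives boundedness.\<close>

lemma prime_sum_jacobi_char_lower_bound:
  assumes "M > 0" "d dvd M" "even k \<or> \<not> is_nth_power 2 d"
  shows "\<exists>B. eventually (\<lambda>s. (-1) ^ k * prime_sum (\<lambda>n. jacobi_char M d n * real n powr -s) \<ge> B) (at_right 1)"
proof (cases "is_nth_power 2 d")
  case True
  have "prime_sum (\<lambda>n. jacobi_char M d n * real n powr -s) \<ge> 0" if "s > 1" for s
    unfolding prime_sum_def
    by (rule suminf_nonneg)
      (use prime_sum_sums[OF summable_jacobi_char] jacobi_char_square_nonneg assms True that in \<open>auto simp: sums_iff\<close>)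
  then show ?thesis
    using assms True by (intro exI[of _ 0] eventually_mono[OF eventually_at_right_less]) auto
next
  case False
  interpret real_character "jacobi_char M d" "8 * M"
    using real_character_jacobi_char assms False by blast
  obtain B where B: "eventually (\<lambda>s. \<bar>prime_sum (\<lambda>n. jacobi_char M d n * real n powr -s)\<bar> \<le> B) (at_right 1)"
    using prime_sum_bounded by blast
  then show ?thesis
    by (intro exI[of _ "-B"], elim eventually_mono) (auto simp: minus_one_power_iff)
qed

lemma infinite_primes_Legendre_minus_one:
  fixes A :: "nat set"
  assumes A: "finite A" "\<And>z. z \<in> A \<Longrightarrow> z > 0"
    and nonsquare: "\<And>T. T \<subseteq> A \<Longrightarrow> odd (card T) \<Longrightarrow> \<not> is_nth_power 2 (\<Prod>T)"
  shows "infinite {p::nat. prime p \<and> odd p \<and> (\<forall>z\<in>A. Legendre (int z) (int p) = -1)}"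
    (is "infinite ?G")
proof
  assume fin: "finite ?G"
  define M where "M = \<Prod>A"
  have M: "M > 0" unfolding M_def using A by (intro prod_pos) auto
  have dvd: "\<Prod>T dvd M" if "T \<subseteq> A" for T
    unfolding M_def using A that by (intro prod_dvd_prod_subset)
  have dvd': "z dvd M" if "z \<in> A" for z using dvd[of "{z}"] that by simp
  define w where "w = (\<lambda>n. \<Sum>T\<in>Pow A. (-1) ^ card T * jacobi_char M (\<Prod>T) n)"
  have w: "w n = (if coprime n (2 * M) then (\<Prod>z\<in>A. 1 - jacobi_char M z n) else 0)" for n
  proof (cases "coprime n (2 * M)")
    case True
    have "(\<Prod>z\<in>A. 1 - jacobi_char M z n) = (\<Sum>T\<in>Pow A. (-1) ^ card T * (\<Prod>z\<in>T. jacobi_char M z n))"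
      using prod_diff_conv_sum[OF A(1), of "\<lambda>_. 1" "\<lambda>z. jacobi_char M z n"] by simp
    also have "\<dots> = w n"
      unfolding w_def
    proof (rule sum.cong)
      fix T assume "T \<in> Pow A"
      then have "finite T" "\<And>z. z \<in> T \<Longrightarrow> z > 0" using A finite_subset by blast+
      then show "(-1) ^ card T * (\<Prod>z\<in>T. jacobi_char M z n) = (-1) ^ card T * jacobi_char M (\<Prod>T) n"
        using True jacobi_char_prod[of T M n] by simp
    qed simp
    finally show ?thesis using True by simp
  next
    case False
    then show ?thesis unfolding w_def jacobi_char_def by (simp only: if_False mult_zero_right sum.neutral_const)
  qed
  \<comment> \<open>No factor \<open>1 - jacobi_char M z p\<close> vanishes, so no Legendre symbol
    is 1; none is 0 either, because \<open>p\<close> is coprime to \<open>M\<close>.\<close>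
  have in_G: "p \<in> ?G" if p: "prime p" "w p \<noteq> 0" for p
  proof -
    have cop: "coprime p (2 * M)" using p w[of p] by (auto split: if_splits)
    have "Legendre (int z) (int p) = -1" if z: "z \<in> A" for z
    proof -
      have "1 - jacobi_char M z p \<noteq> 0" using p w[of p] cop A z by auto
      then have "Legendre (int z) (int p) \<noteq> 1"
        using jacobi_char_prime[OF M dvd'[OF z] p(1) cop] by auto
      moreover have "coprime p M" using cop by simp
      then have "\<not> p dvd z" using dvd'[OF z] p(1)
        by (metis coprime_absorb_left dvd_trans not_prime_unit)
      then have "Legendre (int z) (int p) \<noteq> 0" by (simp add: Legendre_eq_0_iff)
      ultimately show ?thesis using Legendre_values[of "int z" "int p"] by auto
    qed
    moreover have "odd p" using cop by (simp add: coprime_right_2_iff_odd)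
    ultimately show ?thesis using p by blast
  qed
  have w_le: "w n \<le> 2 ^ card A" for n
  proof -
    have "(\<Prod>z\<in>A. 1 - jacobi_char M z n) \<le> (\<Prod>z\<in>A. 2)"
      using jacobi_char_values[OF M dvd', of _ n] by (intro prod_mono) force
    then show ?thesis using w[of n] by simp
  qed
  define W where "W = (\<lambda>s. \<Sum>T\<in>Pow A. (-1) ^ card T * prime_sum (\<lambda>n. jacobi_char M (\<Prod>T) n * real n powr -s))"
  \<comment> \<open>Exchanging the sums turns \<open>W s\<close> into a sum of
    \<open>w p * p powr -s\<close> over primes, supported on the finite set
    \<open>?G\<close>.\<close>
  have upper: "W s \<le> real (card ?G) * 2 ^ card A" if s: "s > 1" for s
  proof -
    define g where "g = (\<lambda>n. \<Sum>T\<in>Pow A. (-1) ^ card T * (if prime n then jacobi_char M (\<Prod>T) n * real n powr -s else 0))"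
    have g: "g n = (if prime n then w n * real n powr -s else 0)" for n
      by (auto simp: g_def w_def sum_distrib_left mult_ac)
    have "g sums W s"
      unfolding g_def W_def
      by (intro sums_sum sums_mult prime_sum_sums summable_jacobi_char M dvd s) auto
    moreover have "g sums sum g ?G"
      using in_G by (intro sums_finite fin) (auto simp: g)
    ultimately have "W s = sum g ?G" by (rule sums_unique2)
    also have "\<dots> \<le> (\<Sum>n\<in>?G. 2 ^ card A)"
    proof (rule sum_mono)
      fix n assume "n \<in> ?G"
      then have n: "prime n" "n > 0" by (auto simp: prime_gt_0_nat)
      have "real n powr -s \<le> real n powr 0" using s n by (intro powr_mono) auto
      then have "w n * real n powr -s \<le> 2 ^ card A * 1"
        using n by (intro mult_mono w_le) auto
      then show "g n \<le> 2 ^ card A" using n by (simp add: g)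
    qed
    finally show ?thesis by simp
  qed
  have "\<forall>T\<in>Pow A - {{}}. \<exists>B. eventually (\<lambda>s. (-1) ^ card T *
          prime_sum (\<lambda>n. jacobi_char M (\<Prod>T) n * real n powr -s) \<ge> B) (at_right 1)"
    using nonsquare by (intro ballI prime_sum_jacobi_char_lower_bound M dvd) auto
  then obtain B where "\<forall>T\<in>Pow A - {{}}. eventually (\<lambda>s. (-1) ^ card T *
          prime_sum (\<lambda>n. jacobi_char M (\<Prod>T) n * real n powr -s) \<ge> B T) (at_right 1)"
    by (rule bchoice[THEN exE])
  then have "eventually (\<lambda>s. \<forall>T\<in>Pow A - {{}}. (-1) ^ card T *
          prime_sum (\<lambda>n. jacobi_char M (\<Prod>T) n * real n powr -s) \<ge> B T) (at_right 1)"
    using A by (intro eventually_ball_finite) auto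
  \<comment> \<open>The threshold is chosen so that, with the lower bounds for all nonempty subsets
    added, \<open>W s\<close> exceeds its upper bound by 1.\<close>
  moreover have "eventually (\<lambda>s. prime_sum (\<lambda>n. jacobi_char M 1 n * real n powr -s) \<ge>
      real (card ?G) * 2 ^ card A - sum B (Pow A - {{}}) + 1) (at_right 1)"
    using prime_sum_jacobi_char_1_at_top[OF M] unfolding filterlim_at_top by blast
  moreover have "eventually (\<lambda>s::real. s > 1) (at_right 1)" by (rule eventually_at_right_less)
  ultimately have "eventually (\<lambda>s::real. False) (at_right 1)"
  proof eventually_elim
    case (elim s)
    have "W s = prime_sum (\<lambda>n. jacobi_char M 1 n * real n powr -s) +
        (\<Sum>T\<in>Pow A - {{}}. (-1) ^ card T * prime_sum (\<lambda>n. jacobi_char M (\<Prod>T) n * real n powr -s))"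
      unfolding W_def using A by (subst sum.remove[of _ "{}"]) auto
    also have "\<dots> \<ge> prime_sum (\<lambda>n. jacobi_char M 1 n * real n powr -s) + sum B (Pow A - {{}})"
      using elim by (intro add_left_mono sum_mono) auto
    finally show ?case using upper[OF elim(3)] elim(2) by linarith
  qed
  then show False by simp
qed

section \<open>Passage to integers and the converse direction\<close>

lemma quad_nonresidue_iff_Legendre: "quad_nonresidue p z \<longleftrightarrow> Legendre z p = -1"
  by (simp add: quad_nonresidue_def Legendre_def cong_0_iff)

theorem theorem4p12:
  fixes S :: "int set"
  assumes "finite S" and "S \<noteq> {}" and "\<forall>i\<in>S. i > 0"
  shows "infinite {p :: int. prime p \<and> odd p \<and> (\<forall>z\<in>S. quad_nonresidue p z)} \<longleftrightarrow>
         (\<forall>T. T \<subseteq> S \<and> odd (card T) \<longrightarrow> \<not> is_nth_power 2 (\<Prod>i\<in>T. i))"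
proof
  let ?P = "{p :: int. prime p \<and> odd p \<and> (\<forall>z\<in>S. quad_nonresidue p z)}"
  assume "infinite ?P"
  then obtain p where p: "prime p" "odd p" "\<And>z. z \<in> S \<Longrightarrow> Legendre z p = -1"
    using not_finite_existsD[of "\<lambda>p. p \<in> ?P"] by (auto simp: quad_nonresidue_iff_Legendre)
  define q where "q = nat p"
  have pq: "p = int q" using prime_ge_0_int[OF p(1)] by (simp add: q_def)
  have "prime q" "odd q" using p by (auto simp: pq)
  then have q: "prime q" "2 < q" by (auto intro: prime_gt_2)
  show "\<forall>T. T \<subseteq> S \<and> odd (card T) \<longrightarrow> \<not> is_nth_power 2 (\<Prod>i\<in>T. i)"
  proof (intro allI impI notI)
    fix T assume T: "T \<subseteq> S \<and> odd (card T)" and "is_nth_power 2 (\<Prod>i\<in>T. i)"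
    then obtain y where "(\<Prod>i\<in>T. i) = y * y" by (auto simp: is_nth_power_def power2_eq_square)
    \<comment> \<open>An odd number of factors -1 would make the square of an integer equal to -1;
      this also covers \<open>y\<close> divisible by \<open>p\<close>.\<close>
    then have "Legendre y p * Legendre y p = (\<Prod>i\<in>T. Legendre i p)"
      using Legendre_mult[OF q, of y y] Legendre_prod[OF q, of "\<lambda>i. i" T] by (simp add: pq)
    also have "\<dots> = (\<Prod>i\<in>T. -1)" using T p(3) by (intro prod.cong) auto
    also have "\<dots> = -1" using T by simp
    finally show False using zero_le_square[of "Legendre y p"] by linarith
  qed
next
  let ?P = "{p :: int. prime p \<and> odd p \<and> (\<forall>z\<in>S. quad_nonresidue p z)}"
  assume nonsq: "\<forall>T. T \<subseteq> S \<and> odd (card T) \<longrightarrow> \<not> is_nth_power 2 (\<Prod>i\<in>T. i)"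
  have int_nat: "int ` nat ` S = S"
    using assms(3) by (force simp: image_image image_iff)
  have "infinite {p::nat. prime p \<and> odd p \<and> (\<forall>z\<in>nat ` S. Legendre (int z) (int p) = -1)}" (is "infinite ?Q")
  proof (rule infinite_primes_Legendre_minus_one)
    fix T assume T: "T \<subseteq> nat ` S" "odd (card T)"
    have "int ` T \<subseteq> S" using T int_nat by blast
    moreover have "card (int ` T) = card T" by (intro card_image) auto
    ultimately have "\<not> is_nth_power 2 (\<Prod>i\<in>int ` T. i)" using nonsq T by simp
    moreover have "(\<Prod>i\<in>int ` T. i) = int (\<Prod>T)" by (subst prod.reindex) auto
    ultimately have "\<not> is_nth_power 2 (int (\<Prod>T))" by simp
    then show "\<not> is_nth_power 2 (\<Prod>T)"
      unfolding is_nth_power_def by (metis of_nat_power)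
  qed (use assms in auto)
  then have "infinite (int ` ?Q)" by (simp add: finite_image_iff)
  moreover have "int ` ?Q \<subseteq> ?P"
  proof safe
    fix p z assume "\<forall>z\<in>nat ` S. Legendre (int z) (int p) = -1" "z \<in> S"
    then have "Legendre (int (nat z)) (int p) = -1" by blast
    moreover have "int (nat z) = z" using assms(3) \<open>z \<in> S\<close> by force
    ultimately show "quad_nonresidue (int p) z" by (simp only: quad_nonresidue_iff_Legendre)
  qed auto
  ultimately show "infinite ?P" using finite_subset by blast
qed


end
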